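(* Let $(G,\mathbf{w})$ be a connected weighted graph with vertices $v_1,\dots,v_n$, and let $w_{ij}=d_\mathbf{w}(v_i,v_j)$. Then $c(G,\mathbf{w})$ equals the optimal value of the integer program $$\min \sum_{A\subseteq [n]} S_A \quad\text{s.t.}\quad \sum_{A\subseteq[n]:\ |A\cap\{i,j\}|=1} S_A \ge w_{ij}\ \ \forall\, 1\le i<j\le n,\qquad S_A\in\mathbb{Z}_{\ge 0}\ \ \forall A\subseteq[n].$$
   Context: A weighted graph $(G,\mathbf{w})$ is a finite simple graph with positive integer edge weights that is weight-minimal: every edge is a shortest path between its endpoints. $d_\mathbf{w}(u,v)$ is the minimum total weight of a $(u,v)$-path. A binary addressing of length $m$ is a map $f:V(G)\to\{0,1\}^m$ with $d_\mathbf{w}(u,v)\le d_H(f(u),f(v))$ for all $u,v$ ($d_H$ the Hamming distance); $c(G,\mathbf{w})$ is the minimum such $m$. $[n]=\{1,\dots,n\}$. *)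

theory Defs
  imports "Graph_Theory.Graph_Theory"
begin

text \<open>A finite simple graph is a \<open>pair_graph\<close>: an undirected edge $uv$ is the pair of
  opposite arcs $(u,v)$, $(v,u)$, so an edge weighting is a symmetric function on arcs.
  Paths are the library's \<open>apath\<close>s (no repeated vertex), given by their lists of arcs.\<close>

definition path_weight :: "('a \<times> 'a \<Rightarrow> nat) \<Rightarrow> ('a \<times> 'a) list \<Rightarrow> nat" where
  "path_weight w p = sum_list (map w p)"

definition shortest_path ::
  "'a pair_pre_digraph \<Rightarrow> ('a \<times> 'a \<Rightarrow> nat) \<Rightarrow> 'a \<Rightarrow> ('a \<times> 'a) list \<Rightarrow> 'a \<Rightarrow> bool" where
  "shortest_path G w u p v \<longleftrightarrow>
     pre_digraph.apath (with_proj G) u p v \<and>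
     (\<forall>q. pre_digraph.apath (with_proj G) u q v \<longrightarrow> path_weight w p \<le> path_weight w q)"

text \<open>Only meaningful if some path joins \<open>u\<close> and \<open>v\<close>; otherwise the value is unspecified.\<close>

definition weighted_dist ::
  "'a pair_pre_digraph \<Rightarrow> ('a \<times> 'a \<Rightarrow> nat) \<Rightarrow> 'a \<Rightarrow> 'a \<Rightarrow> nat" where
  "weighted_dist G w u v =
     (LEAST k. \<exists>p. pre_digraph.apath (with_proj G) u p v \<and> path_weight w p = k)"

locale weighted_graph = pair_graph G for G :: "'a pair_pre_digraph" +
  fixes w :: "'a \<times> 'a \<Rightarrow> nat"
  assumes weight_sym: "(u, v) \<in> parcs G \<Longrightarrow> w (u, v) = w (v, u)"
    and weight_pos: "(u, v) \<in> parcs G \<Longrightarrow> w (u, v) > 0"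
    and weight_minimal: "(u, v) \<in> parcs G \<Longrightarrow> shortest_path G w u [(u, v)] v"

text \<open>The Hamming distance; used only for lists of equal length.\<close>

definition hamming_dist :: "bool list \<Rightarrow> bool list \<Rightarrow> nat" where
  "hamming_dist x y = card {i. i < length x \<and> x ! i \<noteq> y ! i}"

definition binary_addressing ::
  "'a pair_pre_digraph \<Rightarrow> ('a \<times> 'a \<Rightarrow> nat) \<Rightarrow> nat \<Rightarrow> ('a \<Rightarrow> bool list) \<Rightarrow> bool" where
  "binary_addressing G w m f \<longleftrightarrow>
     (\<forall>u \<in> pverts G. length (f u) = m) \<and>
     (\<forall>u \<in> pverts G. \<forall>v \<in> pverts G. weighted_dist G w u v \<le> hamming_dist (f u) (f v))"

definition addressing_number :: "'a pair_pre_digraph \<Rightarrow> ('a \<times> 'a \<Rightarrow> nat) \<Rightarrow> nat" where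
  "addressing_number G w = (LEAST m. \<exists>f. binary_addressing G w m f)"

text \<open>The variables of the integer program are the values of \<open>S\<close> on subsets of \<open>{1..n}\<close>;
  its values elsewhere are irrelevant.\<close>

definition ip_feasible :: "nat \<Rightarrow> (nat \<Rightarrow> nat \<Rightarrow> nat) \<Rightarrow> (nat set \<Rightarrow> int) \<Rightarrow> bool" where
  "ip_feasible n d S \<longleftrightarrow>
     (\<forall>A. A \<subseteq> {1..n} \<longrightarrow> S A \<ge> 0) \<and>
     (\<forall>i j. 1 \<le> i \<and> i < j \<and> j \<le> n \<longrightarrow>
        (\<Sum>A | A \<subseteq> {1..n} \<and> card (A \<inter> {i, j}) = 1. S A) \<ge> int (d i j))"

definition ip_objective :: "nat \<Rightarrow> (nat set \<Rightarrow> int) \<Rightarrow> int" where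
  "ip_objective n S = (\<Sum>A | A \<subseteq> {1..n}. S A)"

definition is_ip_optimal_value :: "nat \<Rightarrow> (nat \<Rightarrow> nat \<Rightarrow> nat) \<Rightarrow> int \<Rightarrow> bool" where
  "is_ip_optimal_value n d z \<longleftrightarrow>
     (\<exists>S. ip_feasible n d S \<and> ip_objective n S = z) \<and>
     (\<forall>S. ip_feasible n d S \<longrightarrow> z \<le> ip_objective n S)"

end

theory Submission
  imports Defs
begin

text \<open>Writing the addresses of the vertices as the rows of a matrix, each column is the indicator
  vector of a subset of \<open>{1..n}\<close>, and the Hamming distance of rows \<open>i\<close> and \<open>j\<close> counts the columns
  whose subset separates \<open>i\<close> from \<open>j\<close>. Hence addressings correspond, up to the order of the columns,
  to feasible points: \<open>S A\<close> is the multiplicity of the column \<open>A\<close>, and the objective is the length.\<close>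

lemma (in weighted_graph) path_weight_rev_path:
  "set p \<subseteq> parcs G \<Longrightarrow> path_weight w (rev_path p) = path_weight w p"
  by (induction p) (auto simp: path_weight_def weight_sym[symmetric])

text \<open>Reversal turns paths from \<open>u\<close> to \<open>v\<close> into paths from
  \<open>v\<close> to \<open>u\<close> of the same weight, so both minima range over the same set.
  This is needed because the program has constraints only for \<open>i < j\<close>, whereas an
  addressing is tested on all ordered pairs.\<close>

lemma (in weighted_graph) weighted_dist_commute: "weighted_dist G w u v = weighted_dist G w v u"
proof -
  have rev: "\<exists>q. apath y q x \<and> path_weight w q = k" if "apath x p y" "path_weight w p = k" for x y p k
  proof -
    have "set p \<subseteq> parcs G"
      using that(1) by (auto simp: apath_def awalk_def)
    then show ?thesis
      using that path_weight_rev_path by (intro exI[of _ "rev_path p"]) simp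
  qed
  have "(\<exists>p. apath u p v \<and> path_weight w p = k) \<longleftrightarrow> (\<exists>p. apath v p u \<and> path_weight w p = k)" for k
    using rev by blast
  then show ?thesis
    unfolding weighted_dist_def by simp
qed

text \<open>The empty path has weight 0. This settles the diagonal pairs of an addressing, for which
  the program has no constraint.\<close>

lemma (in weighted_graph) weighted_dist_self:
  assumes "u \<in> pverts G"
  shows "weighted_dist G w u u = 0"
  unfolding weighted_dist_def
  by (rule Least_equality) (use assms in \<open>auto simp: apath_Nil_iff path_weight_def intro!: exI[of _ "[]"]\<close>)

lemma card_Int_doubleton_eq_1_iff:
  assumes "i \<noteq> j"
  shows "card (A \<inter> {i, j}) = 1 \<longleftrightarrow> (i \<in> A) \<noteq> (j \<in> A)"
  using assms by (cases "i \<in> A"; cases "j \<in> A") auto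

text \<open>The fibres of \<open>g\<close> over the sets satisfying \<open>P\<close> partition the
  positions \<open>k\<close> with \<open>P (g k)\<close>. Taking \<open>P\<close> always true gives
  the objective; taking it to be separation of \<open>i\<close> and \<open>j\<close> gives the left
  side of a constraint.\<close>

lemma sum_card_fibres:
  fixes m :: nat
  assumes "finite X" and "\<And>k. k < m \<Longrightarrow> g k \<subseteq> X"
  shows "(\<Sum>A | A \<subseteq> X \<and> P A. int (card {k. k < m \<and> g k = A})) = int (card {k. k < m \<and> P (g k)})"
proof -
  have "(\<Sum>A | A \<subseteq> X \<and> P A. \<Sum>k | k \<in> {k. k < m \<and> P (g k)} \<and> g k = A. 1::int)
      = (\<Sum>k | k < m \<and> P (g k). 1)"
    by (rule sum.group) (use assms in auto)
  moreover have "{k. k \<in> {k. k < m \<and> P (g k)} \<and> g k = A} = {k. k < m \<and> g k = A}" if "P A" for A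
    using that by auto
  ultimately show ?thesis
    by simp
qed

text \<open>Prescribed multiplicities are realised by enumerating the disjoint union of
  \<open>s A\<close> labelled copies of each \<open>A\<close> and then forgetting the
  labels.\<close>

lemma obtain_fibres_of_card:
  assumes "finite F"
  obtains g :: "nat \<Rightarrow> 'b" where "\<And>k. k < (\<Sum>A\<in>F. s A) \<Longrightarrow> g k \<in> F"
    and "\<And>A. A \<in> F \<Longrightarrow> card {k. k < (\<Sum>A\<in>F. s A) \<and> g k = A} = s A"
proof -
  let ?T = "SIGMA A:F. {..<s A}" and ?m = "\<Sum>A\<in>F. s A"
  have "card ?T = ?m" "finite ?T"
    using assms by auto
  then obtain h where h: "bij_betw h {0..<?m} ?T"
    using ex_bij_betw_nat_finite by metis
  show thesis
  proof
    fix k assume "k < ?m"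
    then show "fst (h k) \<in> F"
      using bij_betwE[OF h] by (force simp del: mem_Sigma_iff elim!: SigmaE)
  next
    fix A assume A: "A \<in> F"
    \<comment> \<open>The positions carrying \<open>A\<close> are exactly those that
      \<open>h\<close> sends to the block of copies of \<open>A\<close>.\<close>
    have "h ` {k. k < ?m \<and> fst (h k) = A} = {A} \<times> {..<s A}"
    proof
      show "h ` {k. k < ?m \<and> fst (h k) = A} \<subseteq> {A} \<times> {..<s A}"
        using bij_betwE[OF h] by (force simp: mem_Times_iff)
      show "{A} \<times> {..<s A} \<subseteq> h ` {k. k < ?m \<and> fst (h k) = A}"
      proof
        fix x assume x: "x \<in> {A} \<times> {..<s A}"
        then have "x \<in> h ` {0..<?m}"
          using A bij_betw_imp_surj_on[OF h] by auto
        then obtain k where "k < ?m" "x = h k"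
          by auto
        with x show "x \<in> h ` {k. k < ?m \<and> fst (h k) = A}"
          by (intro image_eqI[of _ _ k]) (auto simp: mem_Times_iff)
      qed
    qed
    then have "card (h ` {k. k < ?m \<and> fst (h k) = A}) = s A"
      by simp
    moreover have "inj_on h {k. k < ?m \<and> fst (h k) = A}"
      by (rule inj_on_subset[OF bij_betw_imp_inj_on[OF h]]) auto
    ultimately show "card {k. k < ?m \<and> fst (h k) = A} = s A"
      by (simp add: card_image)
  qed
qed

lemma feasible_of_addressing:
  assumes f: "binary_addressing G w m f" and v: "v ` {1..n} \<subseteq> pverts G"
  obtains S where "ip_feasible n (\<lambda>i j. weighted_dist G w (v i) (v j)) S"
    and "ip_objective n S = int m"
proof
  \<comment> \<open>Column \<open>k\<close> of the address matrix, as a set of row indices.\<close>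
  define g where "g k = {i \<in> {1..n}. f (v i) ! k}" for k
  define S where "S A = int (card {k. k < m \<and> g k = A})" for A
  have sum_S: "(\<Sum>A | A \<subseteq> {1..n} \<and> P A. S A) = int (card {k. k < m \<and> P (g k)})" for P
    unfolding S_def by (rule sum_card_fibres) (auto simp: g_def)
  show "ip_objective n S = int m"
    using sum_S[of "\<lambda>_. True"] by (simp add: ip_objective_def)
  show "ip_feasible n (\<lambda>i j. weighted_dist G w (v i) (v j)) S"
    unfolding ip_feasible_def
  proof (intro conjI allI impI)
    show "0 \<le> S A" for A
      by (simp add: S_def)
    fix i j assume ij: "1 \<le> i \<and> i < j \<and> j \<le> n"
    then have verts: "v i \<in> pverts G" "v j \<in> pverts G"
      using v by auto
    have "weighted_dist G w (v i) (v j) \<le> hamming_dist (f (v i)) (f (v j))"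
      using f verts by (auto simp: binary_addressing_def)
    also have "\<dots> = card {k. k < m \<and> card (g k \<inter> {i, j}) = 1}"
    proof -
      have "length (f (v i)) = m"
        using f verts by (auto simp: binary_addressing_def)
      moreover have "card (g k \<inter> {i, j}) = 1 \<longleftrightarrow> f (v i) ! k \<noteq> f (v j) ! k" for k
        using ij by (subst card_Int_doubleton_eq_1_iff) (auto simp: g_def)
      ultimately show ?thesis
        by (simp add: hamming_dist_def)
    qed
    finally show "int (weighted_dist G w (v i) (v j)) \<le> (\<Sum>A | A \<subseteq> {1..n} \<and> card (A \<inter> {i, j}) = 1. S A)"
      unfolding sum_S by simp
  qed
qed

lemma (in weighted_graph) addressing_of_feasible:
  assumes S: "ip_feasible n (\<lambda>i j. weighted_dist G w (v i) (v j)) S"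
    and v: "bij_betw v {1..n} (pverts G)"
  obtains m f where "binary_addressing G w m f" and "int m = ip_objective n S"
proof -
  \<comment> \<open>Feasibility makes every \<open>S A\<close> nonnegative, so \<open>nat\<close>
    loses nothing here.\<close>
  define m where "m = (\<Sum>A\<in>Pow {1..n}. nat (S A))"
  have S_nonneg: "0 \<le> S A" if "A \<subseteq> {1..n}" for A
    using S that by (auto simp: ip_feasible_def)
  obtain g where g: "\<And>k. k < m \<Longrightarrow> g k \<in> Pow {1..n}"
      "\<And>A. A \<in> Pow {1..n} \<Longrightarrow> card {k. k < m \<and> g k = A} = nat (S A)"
    unfolding m_def by (rule obtain_fibres_of_card[of "Pow {1..n}" "\<lambda>A. nat (S A)"]) auto
  have sum_S: "(\<Sum>A | A \<subseteq> {1..n} \<and> P A. S A) = int (card {k. k < m \<and> P (g k)})" for P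
  proof -
    have "(\<Sum>A | A \<subseteq> {1..n} \<and> P A. S A)
        = (\<Sum>A | A \<subseteq> {1..n} \<and> P A. int (card {k. k < m \<and> g k = A}))"
      by (rule sum.cong) (use g(2) S_nonneg in auto)
    also have "\<dots> = int (card {k. k < m \<and> P (g k)})"
      by (rule sum_card_fibres) (use g(1) in auto)
    finally show ?thesis .
  qed
  define idx where "idx = inv_into {1..n} v"
  \<comment> \<open>The address of \<open>u\<close> is row \<open>idx u\<close> of the matrix whose
    columns are \<open>g 0\<close>, ..., \<open>g (m - 1)\<close>.\<close>
  define f where "f u = map (\<lambda>k. idx u \<in> g k) [0..<m]" for u
  have idx: "idx u \<in> {1..n}" "v (idx u) = u" if "u \<in> pverts G" for u
    using that bij_betw_imp_surj_on[OF v] inv_into_into[of u v "{1..n}"] f_inv_into_f[of u v "{1..n}"]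
    by (simp_all add: idx_def)
  have dist_le: "weighted_dist G w x y \<le> hamming_dist (f x) (f y)"
    if "x \<in> pverts G" "y \<in> pverts G" "idx x < idx y" for x y
  proof -
    have "int (weighted_dist G w (v (idx x)) (v (idx y)))
        \<le> (\<Sum>A | A \<subseteq> {1..n} \<and> card (A \<inter> {idx x, idx y}) = 1. S A)"
    proof -
      have "1 \<le> idx x \<and> idx x < idx y \<and> idx y \<le> n"
        using that idx(1) by simp
      then show ?thesis
        using S unfolding ip_feasible_def by blast
    qed
    also have "\<dots> = int (card {k. k < m \<and> (idx x \<in> g k) \<noteq> (idx y \<in> g k)})"
      unfolding sum_S using that(3) by (subst card_Int_doubleton_eq_1_iff) auto
    also have "{k. k < m \<and> (idx x \<in> g k) \<noteq> (idx y \<in> g k)}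
        = {k. k < length (f x) \<and> f x ! k \<noteq> f y ! k}"
      by (auto simp: f_def)
    finally show ?thesis
      using that by (simp add: hamming_dist_def idx(2))
  qed
  have hamming_commute: "hamming_dist (f x) (f y) = hamming_dist (f y) (f x)" for x y
    by (auto simp: hamming_dist_def f_def intro: arg_cong[where f = card])
  have "weighted_dist G w x y \<le> hamming_dist (f x) (f y)"
    if "x \<in> pverts G" "y \<in> pverts G" for x y
  proof (cases "idx x" "idx y" rule: linorder_cases)
    case less
    with that show ?thesis by (rule dist_le)
  next
    case equal
    then have "x = y"
      using that idx(2) by metis
    then show ?thesis
      using that by (simp add: weighted_dist_self)
  next
    case greater
    then show ?thesis
      using dist_le[of y x] that weighted_dist_commute hamming_commute by metis
  qed
  then have "binary_addressing G w m f"
    by (auto simp: binary_addressing_def f_def)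
  moreover have "int m = ip_objective n S"
    using sum_S[of "\<lambda>_. True"] by (simp add: ip_objective_def)
  ultimately show thesis
    by (rule that)
qed

text \<open>Giving every subset the sum of all \<open>d i j\<close> is wasteful but feasible.
  Converting such a point into an addressing shows that the \<open>LEAST\<close> in
  \<open>addressing_number\<close> is attained.\<close>

lemma ip_feasible_exists: "\<exists>S. ip_feasible n d S"
proof
  let ?S = "\<lambda>A::nat set. \<Sum>i\<in>{1..n}. \<Sum>j\<in>{1..n}. int (d i j)"
  show "ip_feasible n d ?S"
    unfolding ip_feasible_def
  proof (intro conjI allI impI)
    show "0 \<le> ?S A" for A
      by (intro sum_nonneg) simp
    fix i j assume ij: "1 \<le> i \<and> i < j \<and> j \<le> n"
    have "int (d i j) \<le> (\<Sum>j\<in>{1..n}. int (d i j))"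
      using ij by (intro member_le_sum) auto
    also have "\<dots> \<le> ?S {i}"
      using ij by (intro member_le_sum[where f = "\<lambda>i. \<Sum>j\<in>{1..n}. int (d i j)"] sum_nonneg) auto
    \<comment> \<open>The singleton \<open>{i}\<close> separates \<open>i\<close> from
      \<open>j\<close>, so its term alone meets the constraint.\<close>
    also have "\<dots> \<le> (\<Sum>A | A \<subseteq> {1..n} \<and> card (A \<inter> {i, j}) = 1. ?S A)"
      using ij by (intro member_le_sum[where f = ?S and i = "{i}"] sum_nonneg) auto
    finally show "int (d i j) \<le> (\<Sum>A | A \<subseteq> {1..n} \<and> card (A \<inter> {i, j}) = 1. ?S A)" .
  qed
qed

theorem theorem4:
  fixes G :: "'a pair_pre_digraph" and w :: "'a \<times> 'a \<Rightarrow> nat"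
    and n :: nat and v :: "nat \<Rightarrow> 'a"
  assumes "weighted_graph G w"
    and "connected (with_proj G)"
    and "bij_betw v {1..n} (pverts G)"
  shows "is_ip_optimal_value n (\<lambda>i j. weighted_dist G w (v i) (v j))
           (int (addressing_number G w))"
proof -
  interpret weighted_graph G w by fact
  let ?d = "\<lambda>i j. weighted_dist G w (v i) (v j)"
  have addressing: "\<exists>m f. binary_addressing G w m f \<and> int m = ip_objective n S"
    if "ip_feasible n ?d S" for S
    using addressing_of_feasible[OF that assms(3)] by metis
  have "\<exists>m f. binary_addressing G w m f"
    using addressing ip_feasible_exists by metis
  then obtain f where "binary_addressing G w (addressing_number G w) f"
    using LeastI_ex[of "\<lambda>m. \<exists>f. binary_addressing G w m f"] unfolding addressing_number_def by blast
  then obtain S where "ip_feasible n ?d S" "ip_objective n S = int (addressing_number G w)"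
    by (rule feasible_of_addressing[OF _ equalityD1[OF bij_betw_imp_surj_on[OF assms(3)]]])
  \<comment> \<open>A feasible point with a smaller objective would yield an addressing shorter than
    the minimum.\<close>
  moreover have "int (addressing_number G w) \<le> ip_objective n S" if S: "ip_feasible n ?d S" for S
  proof -
    obtain m f where m: "binary_addressing G w m f" "int m = ip_objective n S"
      using addressing[OF S] by blast
    then have "addressing_number G w \<le> m"
      unfolding addressing_number_def by (metis (mono_tags, lifting) Least_le)
    with m show ?thesis
      by simp
  qed
  ultimately show ?thesis
    unfolding is_ip_optimal_value_def by blast
qed

end
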